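(* There exist three partition matroids $M_1,M_2,M_3$ on a common finite ground set $E$ such that, writing $I_k$ for the number of subsets of $E$ of size $k$ that are independent in all three of $M_1,M_2,M_3$, the sequence $I_0,I_1,\ldots,I_{|E|}$ is not log-concave.
   Context: A partition matroid on a finite set $E$ is given by a partition of $E$ into parts; its independent sets are the subsets of $E$ containing at most one element of each part. A sequence $a_0,a_1,\ldots,a_n$ is log-concave if it is non-negative, has no internal zeroes (the indices of its non-zero elements form an interval of integers), and satisfies $a_{i-1}a_{i+1}\leq a_i^2$ for every $1\leq i\leq n-1$. *)

theory Defs
  imports Complex_Main "HOL-Library.Disjoint_Sets"
begin

text \<open>A matroid on \<open>E\<close> is represented by its family of independent sets.\<close>

definition partition_matroid_indep :: "'a set \<Rightarrow> 'a set set \<Rightarrow> 'a set set" where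
  "partition_matroid_indep E P = {S. S \<subseteq> E \<and> (\<forall>B\<in>P. card (S \<inter> B) \<le> 1)}"

definition is_partition_matroid :: "'a set \<Rightarrow> 'a set set \<Rightarrow> bool" where
  "is_partition_matroid E M \<longleftrightarrow>
     finite E \<and> (\<exists>P. partition_on E P \<and> M = partition_matroid_indep E P)"

definition num_common_indep ::
    "'a set set \<Rightarrow> 'a set set \<Rightarrow> 'a set set \<Rightarrow> nat \<Rightarrow> nat" where
  "num_common_indep M1 M2 M3 k = card {S. S \<in> M1 \<and> S \<in> M2 \<and> S \<in> M3 \<and> card S = k}"

text \<open>The finite sequence is \<open>a 0, \<dots>, a n\<close>; values of \<open>a\<close> beyond \<open>n\<close> are irrelevant.\<close>

definition log_concave :: "nat \<Rightarrow> (nat \<Rightarrow> real) \<Rightarrow> bool" where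
  "log_concave n a \<longleftrightarrow>
     (\<forall>i\<le>n. 0 \<le> a i) \<and>
     (\<forall>i j k. i < j \<and> j < k \<and> k \<le> n \<and> a i \<noteq> 0 \<and> a k \<noteq> 0 \<longrightarrow> a j \<noteq> 0) \<and>
     (\<forall>i. 1 \<le> i \<and> i < n \<longrightarrow> a (i - 1) * a (i + 1) \<le> (a i)\<^sup>2)"

end

(* Take seven parallel central elements 0,...,6 and three leaves 7,8,9, where leaf i lies in the
   same part as the centre only in the i-th partition. A common independent set is then either a
   single central element or an arbitrary set of leaves, so the generating polynomial is
   1 + 10 x + 3 x^2 + x^3, and 10 * 1 > 3^2. *)
theory Submission
  imports Defs
begin

definition star_partition :: "nat \<Rightarrow> nat set set" where
  "star_partition i = insert (insert i {..<7}) ((\<lambda>j. {j}) ` ({7,8,9} - {i}))"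

lemma partition_on_star_partition:
  assumes "i \<in> {7,8,9}"
  shows "partition_on {..<10} (star_partition i)"
proof (rule partition_onI)
  have "{..<10} = {..<7} \<union> {7,8,9::nat}" by auto
  with assms show "\<Union> (star_partition i) = {..<10}"
    by (auto simp: star_partition_def)
qed (use assms in \<open>auto simp: star_partition_def disjnt_def\<close>)

text \<open>A singleton block meets every set in at most one element, so only the large block
  constrains \<open>S\<close>.\<close>

lemma star_partition_indep_iff:
  "S \<in> partition_matroid_indep {..<10} (star_partition i) \<longleftrightarrow>
     S \<subseteq> {..<10} \<and> card (S \<inter> insert i {..<7}) \<le> 1"
proof -
  have "card (S \<inter> {j}) \<le> 1" for j
    by (metis card.empty card.insert card_mono empty_iff finite.emptyI finite.insertI
        inf_le2 One_nat_def)
  then show ?thesis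
    by (auto simp: partition_matroid_indep_def star_partition_def)
qed

text \<open>Every pair containing a central element lies in the large block of some partition,
  whereas two leaves never share a block.\<close>

lemma common_indep_star_iff:
  "(\<forall>i\<in>{7,8,9}. S \<in> partition_matroid_indep {..<10} (star_partition i)) \<longleftrightarrow>
     S \<subseteq> {7,8,9} \<or> (\<exists>x<7. S = {x})"
  (is "?L \<longleftrightarrow> ?R")
proof
  assume ?L
  \<comment> \<open>The cardinality bound is recast as equality of any two elements of the
    intersection, which is legitimate because the large block is finite.\<close>
  then have sub: "S \<subseteq> {..<10}"
    and uniq: "\<And>i x y. i \<in> {7,8,9} \<Longrightarrow> x \<in> S \<inter> insert i {..<7} \<Longrightarrow> y \<in> S \<inter> insert i {..<7} \<Longrightarrow> x = y"
    by (force simp: star_partition_indep_iff,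
        metis One_nat_def \<open>?L\<close> card_le_Suc0_iff_eq finite_Int finite_insert finite_lessThan
          star_partition_indep_iff)
  show ?R
  proof (cases "\<exists>x\<in>S. x < 7")
    case True
    then obtain x where x: "x \<in> S" "x < 7" by blast
    have "y = x" if y: "y \<in> S" for y
    proof -
      have "y < 7 \<or> y \<in> {7,8,9}" using sub y by auto
      \<comment> \<open>For central \<open>y\<close> any of the three indices would do, and 7 is an
        arbitrary choice; a leaf \<open>y\<close> conflicts with \<open>x\<close> in the partition
        indexed by \<open>y\<close> itself.\<close>
      with x y show ?thesis
        using uniq[of 7 y x] uniq[of y y x] by auto
    qed
    with x show ?thesis by blast
  next
    case False
    have "x \<in> {7,8,9}" if "x \<in> S" for x
    proof -
      have "x < 10" "\<not> x < 7" using that sub False by auto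
      then show ?thesis by auto
    qed
    then show ?thesis by blast
  qed
next
  assume R: ?R
  then have "S \<subseteq> {..<10}" by auto
  \<comment> \<open>A set of leaves can meet the large block only in \<open>i\<close>.\<close>
  moreover have "card (S \<inter> insert i {..<7}) \<le> 1" if "i \<in> {7,8,9}" for i
    using R that by (auto simp: card_le_Suc0_iff_eq)
  ultimately show ?L
    by (simp add: star_partition_indep_iff)
qed

abbreviation "star_count \<equiv> num_common_indep (partition_matroid_indep {..<10} (star_partition 7))
  (partition_matroid_indep {..<10} (star_partition 8))
  (partition_matroid_indep {..<10} (star_partition 9))"

lemma star_count_eq:
  "star_count k = card {S. (S \<subseteq> {7,8,9::nat} \<or> (\<exists>x<7. S = {x})) \<and> card S = k}"
  unfolding num_common_indep_def common_indep_star_iff[symmetric] by (simp add: conj_assoc)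

text \<open>Each of the ten elements is central or a leaf, so all singletons are common independent
  sets.\<close>

lemma star_count_1: "star_count 1 = 10"
proof -
  have "{S. (S \<subseteq> {7,8,9} \<or> (\<exists>x<7. S = {x})) \<and> card S = 1} = {S. S \<subseteq> {..<10::nat} \<and> card S = 1}"
    by (auto simp: card_Suc_eq)
  then show ?thesis
    by (simp only: star_count_eq n_subsets finite_lessThan card_lessThan) simp
qed

text \<open>From size 2 on, the central singletons drop out and only sets of leaves remain.\<close>

lemma star_count_ge_2:
  assumes "k \<ge> 2"
  shows "star_count k = 3 choose k"
proof -
  have "{S. (S \<subseteq> {7,8,9} \<or> (\<exists>x<7. S = {x})) \<and> card S = k} = {S. S \<subseteq> {7,8,9::nat} \<and> card S = k}"
    using assms by auto
  then show ?thesis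
    by (simp add: star_count_eq n_subsets numeral_3_eq_3)
qed

theorem mainTheorem6:
  "\<exists>(E :: nat set) M1 M2 M3.
     finite E \<and>
     is_partition_matroid E M1 \<and> is_partition_matroid E M2 \<and> is_partition_matroid E M3 \<and>
     \<not> log_concave (card E) (\<lambda>k. real (num_common_indep M1 M2 M3 k))"
proof -
  have "is_partition_matroid {..<10} (partition_matroid_indep {..<10} (star_partition i))"
    if "i \<in> {7,8,9}" for i
    using partition_on_star_partition[OF that] by (auto simp: is_partition_matroid_def)
  moreover have "\<not> log_concave (card {..<10::nat}) (\<lambda>k. real (star_count k))"
  proof
    assume "log_concave (card {..<10::nat}) (\<lambda>k. real (star_count k))"
    \<comment> \<open>Log-concavity is tested at index 2, an interior index since 2 < 10; the
      neighbours stay unevaluated to match the definition.\<close>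
    then have "real (star_count (2 - 1)) * real (star_count (2 + 1)) \<le> (real (star_count 2))\<^sup>2"
      unfolding log_concave_def by (metis (no_types, lifting) card_lessThan one_le_numeral
        numeral_less_iff semiring_norm(76) semiring_norm(77) semiring_norm(78))
    moreover have "star_count (2 - 1) = 10" "star_count (2 + 1) = 1" "star_count 2 = 3"
      using star_count_1 star_count_ge_2[of 3] star_count_ge_2[of 2]
      by (simp_all add: numeral_eq_Suc)
    ultimately show False by simp
  qed
  ultimately show ?thesis by (meson finite_lessThan insertCI)
qed

end
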